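(* Let $V$ be a set of $n$ vertices and let $\Delta\ge 1$ be an integer. The minimum number of queries of a deterministic non-adaptive algorithm (using maximal independent set queries) that reconstructs any graph on $V$ of maximum degree $\Delta$ is at least $t(n,2,2\Delta-2)$ and at most $t(n,2,2\Delta)$.
   Context: For a graph $G$ on $V$ and $Q\subseteq V$, $G[Q]$ is the subgraph of $G$ induced by $Q$. In the maximal independent set query model, an algorithm queries a set $Q\subseteq V$ and obtains a maximal independent set of $G[Q]$, where $G$ is the hidden graph; it has to reconstruct all edges of $G$. Non-adaptive means that queries do not depend on the outcomes of other queries. Formally, a deterministic non-adaptive algorithm corresponds to a query scheme: a family of queries $\mathcal{Q}\subseteq\mathcal{P}(V)$ such that for all distinct graphs $G$ and $H$ on $V$ with maximum degree $\Delta$ (meaning at most $\Delta$) there exists a query $Q\in\mathcal{Q}$ such that no set of vertices is a maximal independent set of both $G[Q]$ and $H[Q]$. The number of queries is $|\mathcal{Q}|$. A family of sets $\mathcal{F}$ is $(w,r)$-cover-free if for all $A_1,\dots,A_w\in\mathcal{F}$ and all $B_1,\dots,B_r\in\mathcal{F}\setminus\{A_1,\dots,A_w\}$ we have $\bigcap_{i=1}^w A_i\nsubseteq\bigcup_{i=1}^r B_i$ (an empty union is the empty set). For a given $n$, $t(n,w,r)$ denotes the minimal $t$ such that there exists a $(w,r)$-cover-free family $\mathcal{F}\subseteq\mathcal{P}(\{1,\dots,t\})$ with $n$ sets.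
   Formalization: The lower bound fails for small n, so it is stated for all (n,Δ) except (2,1) if A_1, A_2 in "cover-free" are distinct, and for n ≥ 3 and n ≥ 2Δ if A_1 = A_2 is allowed; the upper bound is unrestricted under both readings. *)

theory Defs
  imports Main
begin

text \<open>
  A finite simple graph on the vertex set \<open>V\<close> is given by its set of edges, each edge being a
  two-element subset of \<open>V\<close>; two graphs on \<open>V\<close> are equal iff their edge sets are.
\<close>

definition simple_graph :: "'a set \<Rightarrow> 'a set set \<Rightarrow> bool" where
  "simple_graph V E \<longleftrightarrow> finite V \<and> (\<forall>e\<in>E. e \<subseteq> V \<and> card e = 2)"

definition degree :: "'a set set \<Rightarrow> 'a \<Rightarrow> nat" where
  "degree E v = card {e \<in> E. v \<in> e}"

definition max_degree_at_most :: "'a set \<Rightarrow> 'a set set \<Rightarrow> nat \<Rightarrow> bool" where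
  "max_degree_at_most V E \<Delta> \<longleftrightarrow> (\<forall>v\<in>V. degree E v \<le> \<Delta>)"

text \<open>The induced subgraph on \<open>Q\<close> is the graph with vertex set \<open>Q\<close> and the following edges.\<close>

definition induced_edges :: "'a set set \<Rightarrow> 'a set \<Rightarrow> 'a set set" where
  "induced_edges E Q = {e \<in> E. e \<subseteq> Q}"

definition independent_set :: "'a set \<Rightarrow> 'a set set \<Rightarrow> 'a set \<Rightarrow> bool" where
  "independent_set V E S \<longleftrightarrow> S \<subseteq> V \<and> (\<forall>u\<in>S. \<forall>v\<in>S. {u, v} \<notin> E)"

definition maximal_independent_set :: "'a set \<Rightarrow> 'a set set \<Rightarrow> 'a set \<Rightarrow> bool" where
  "maximal_independent_set V E S \<longleftrightarrow>
     independent_set V E S \<and> (\<forall>T. independent_set V E T \<longrightarrow> S \<subseteq> T \<longrightarrow> T = S)"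

definition query_scheme :: "'a set \<Rightarrow> nat \<Rightarrow> 'a set set \<Rightarrow> bool" where
  "query_scheme V \<Delta> \<Q> \<longleftrightarrow> \<Q> \<subseteq> Pow V \<and>
     (\<forall>G H. simple_graph V G \<and> max_degree_at_most V G \<Delta> \<and>
            simple_graph V H \<and> max_degree_at_most V H \<Delta> \<and> G \<noteq> H \<longrightarrow>
        (\<exists>Q\<in>\<Q>. \<not> (\<exists>S. maximal_independent_set Q (induced_edges G Q) S \<and>
                       maximal_independent_set Q (induced_edges H Q) S)))"

text \<open>
  For finite \<open>V\<close> the minimum is over a nonempty set: \<^term>\<open>Pow V\<close> is a query scheme, since the
  query \<open>{u, v}\<close> decides whether \<open>{u, v}\<close> is an edge.
\<close>

definition min_queries :: "'a set \<Rightarrow> nat \<Rightarrow> nat" where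
  "min_queries V \<Delta> = (LEAST m. \<exists>\<Q>. query_scheme V \<Delta> \<Q> \<and> card \<Q> = m)"

text \<open>
  In \<open>cover_free\<close> neither the \<open>A i\<close> nor the \<open>B i\<close> are required to be distinct. In
  \<open>cover_free_distinct\<close> the \<open>A i\<close> are \<open>w\<close> distinct members of the family, while the \<open>B i\<close> may still
  repeat (so that fewer than \<open>r\<close> further sets are covered by the condition, provided there is at
  least one). The two notions agree on families with at least \<open>w + r\<close> members. They differ on
  smaller ones: for \<open>w = 2\<close> the first also demands that no member is contained in the union of
  \<open>r\<close> others, even if these are all the other members.
\<close>

definition cover_free :: "nat \<Rightarrow> nat \<Rightarrow> 'b set set \<Rightarrow> bool" where
  "cover_free w r \<F> \<longleftrightarrow>
     (\<forall>A B :: nat \<Rightarrow> 'b set. A ` {1..w} \<subseteq> \<F> \<and> B ` {1..r} \<subseteq> \<F> - A ` {1..w} \<longrightarrow>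
        \<not> (\<Inter>i\<in>{1..w}. A i) \<subseteq> (\<Union>i\<in>{1..r}. B i))"

definition cover_free_distinct :: "nat \<Rightarrow> nat \<Rightarrow> 'b set set \<Rightarrow> bool" where
  "cover_free_distinct w r \<F> \<longleftrightarrow>
     (\<forall>A B :: nat \<Rightarrow> 'b set.
        inj_on A {1..w} \<and> A ` {1..w} \<subseteq> \<F> \<and> B ` {1..r} \<subseteq> \<F> - A ` {1..w} \<longrightarrow>
        \<not> (\<Inter>i\<in>{1..w}. A i) \<subseteq> (\<Union>i\<in>{1..r}. B i))"

text \<open>
  Both minima below are over nonempty sets: introduce one point for every nonempty set of at most
  \<open>max w 1\<close> indices in \<open>{1..n}\<close>, and let the \<open>i\<close>-th member consist of the points whose index set
  contains \<open>i\<close>.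
\<close>

definition t_cff :: "nat \<Rightarrow> nat \<Rightarrow> nat \<Rightarrow> nat" where
  "t_cff n w r = (LEAST t. \<exists>\<F> \<subseteq> Pow {1..t}. card \<F> = n \<and> cover_free w r \<F>)"

definition t_cff_distinct :: "nat \<Rightarrow> nat \<Rightarrow> nat \<Rightarrow> nat" where
  "t_cff_distinct n w r = (LEAST t. \<exists>\<F> \<subseteq> Pow {1..t}. card \<F> = n \<and> cover_free_distinct w r \<F>)"

text \<open>
  The side conditions needed for the lower bound \<open>r = 2 * \<Delta> - 2\<close>. With \<open>cover_free_distinct\<close> the
  only exception is \<open>n = 2\<close>, \<open>\<Delta> = 1\<close>: the single query \<open>V\<close> suffices, but two distinct intersecting
  sets need two points. With \<open>cover_free\<close> the bound fails whenever \<open>3 \<le> n < 2 * \<Delta>\<close>: the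
  \<open>n choose 2\<close> pairs are a query scheme, but a cover-free family then needs a private point
  for each member and each pair, that is \<open>n + (n choose 2)\<close> points. It also fails for \<open>n = 2\<close>
  (two points against one query) and for \<open>n = 1\<close>, \<open>\<Delta> = 1\<close> (one point against none).
\<close>

end

theory Submission imports Defs begin

text \<open>
  The dual of a set of queries assigns to every vertex the set of queries that contain it. Up to
  degenerate cases, the dual is \<open>(2, r)\<close>-cover-free iff for any two vertices \<open>u, v\<close> and any \<open>r\<close>
  further vertices some query contains \<open>u, v\<close> and misses the others.

  Such queries with \<open>r = 2 * \<Delta>\<close> suffice: if \<open>{u, v}\<close> is an edge of \<open>G\<close> but not of \<open>H\<close>, let a query
  contain \<open>u, v\<close> and miss all their neighbours in \<open>H\<close>; then every maximal independent set of the
  induced subgraph of \<open>H\<close> contains both \<open>u\<close> and \<open>v\<close>. For \<open>r = 2 * \<Delta> - 2\<close> they are necessary: join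
  half of the \<open>r\<close> vertices to \<open>u\<close>, the others to \<open>v\<close>, and compare this graph with the one that has
  the additional edge \<open>{u, v}\<close>. If a query contains a neighbour \<open>b\<close> of \<open>u\<close>, then a maximal
  independent set through \<open>b\<close> avoids \<open>u\<close>, so it serves both graphs.
\<close>

definition isolates_pairs :: "'a set \<Rightarrow> nat \<Rightarrow> 'a set set \<Rightarrow> bool" where
  "isolates_pairs V r \<Q> \<longleftrightarrow>
     (\<forall>u\<in>V. \<forall>v\<in>V. \<forall>B. u \<noteq> v \<and> B \<subseteq> V - {u, v} \<and> card B \<le> r \<longrightarrow>
        (\<exists>Q\<in>\<Q>. u \<in> Q \<and> v \<in> Q \<and> Q \<inter> B = {}))"

lemma isolates_pairsD:
  assumes "isolates_pairs V r \<Q>" "u \<in> V" "v \<in> V" "u \<noteq> v" "B \<subseteq> V - {u, v}" "card B \<le> r"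
  obtains Q where "Q \<in> \<Q>" "u \<in> Q" "v \<in> Q" "Q \<inter> B = {}"
  using assms unfolding isolates_pairs_def by meson

definition dual :: "'a set set \<Rightarrow> 'a \<Rightarrow> 'a set set" where
  "dual \<Q> v = {Q \<in> \<Q>. v \<in> Q}"

subsection \<open>Graphs and independent sets\<close>

lemma independent_set_antimono:
  "independent_set V F S \<Longrightarrow> E \<subseteq> F \<Longrightarrow> independent_set V E S"
  by (auto simp: independent_set_def)

lemma ex_maximal_independent_set:
  assumes "finite V" "independent_set V E S"
  shows "\<exists>M. S \<subseteq> M \<and> maximal_independent_set V E M"
proof -
  have "{T. independent_set V E T} \<subseteq> Pow V"
    by (auto simp: independent_set_def)
  then have "finite {T. independent_set V E T}"
    using assms(1) by (meson finite_Pow_iff finite_subset)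
  from finite_has_maximal2[OF this, of S] assms(2)
  show ?thesis
    unfolding maximal_independent_set_def by auto
qed

lemma degree_mono:
  assumes "finite F" "E \<subseteq> F"
  shows "degree E v \<le> degree F v"
  unfolding degree_def using assms by (intro card_mono) auto

lemma simple_graph_finite_edges: "simple_graph V E \<Longrightarrow> finite E"
  unfolding simple_graph_def by (meson PowI finite_Pow_iff finite_subset subsetI)

lemma simple_graph_no_loop: "simple_graph V E \<Longrightarrow> {v} \<notin> E"
  by (auto simp: simple_graph_def)

lemma card_neighbours_le_degree:
  assumes "finite E"
  shows "card {x. {v, x} \<in> E} \<le> degree E v"
  unfolding degree_def
proof (rule card_inj_on_le)
  show "inj_on (\<lambda>x. {v, x}) {x. {v, x} \<in> E}"
    by (auto simp: inj_on_def doubleton_eq_iff)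
qed (use assms in auto)

subsection \<open>Query schemes and pair-isolating queries\<close>

lemma no_common_maximal_independent_set:
  assumes "{u, v} \<in> G" "u \<in> Q" "v \<in> Q"
    and isolated: "\<And>x. x \<in> Q \<Longrightarrow> {u, x} \<notin> H \<and> {v, x} \<notin> H"
  shows "\<not> (\<exists>S. maximal_independent_set Q (induced_edges G Q) S \<and>
                maximal_independent_set Q (induced_edges H Q) S)"
proof
  assume "\<exists>S. maximal_independent_set Q (induced_edges G Q) S \<and>
              maximal_independent_set Q (induced_edges H Q) S"
  then obtain S where S: "independent_set Q (induced_edges G Q) S"
      "maximal_independent_set Q (induced_edges H Q) S"
    by (auto simp: maximal_independent_set_def)
  have isolated': "{x, u} \<notin> H" "{x, v} \<notin> H" if "x \<in> Q" for x
    using isolated[OF that] by (simp_all add: insert_commute)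
  have "independent_set Q (induced_edges H Q) S"
    using S(2) by (simp add: maximal_independent_set_def)
  \<comment> \<open>Taking \<open>x = u\<close> and \<open>x = v\<close> in \<open>isolated\<close>
    also excludes loops at \<open>u\<close>, \<open>v\<close> and the edge \<open>{u, v}\<close>
    from \<open>H\<close>, so both vertices can be added to \<open>S\<close> at once.\<close>
  then have "independent_set Q (induced_edges H Q) (insert u (insert v S))"
    using assms(2,3) isolated isolated'
    unfolding independent_set_def induced_edges_def by blast
  then have "insert u (insert v S) = S"
    using S(2) unfolding maximal_independent_set_def by (metis subset_insertI2 subset_refl)
  then have "u \<in> S" "v \<in> S"
    by blast+
  then have "{u, v} \<notin> induced_edges G Q"
    using S(1) by (simp add: independent_set_def)
  then show False
    using assms(1-3) by (simp add: induced_edges_def)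
qed

lemma query_scheme_if_isolates_pairs:
  assumes "\<Q> \<subseteq> Pow V" "isolates_pairs V (2 * \<Delta>) \<Q>"
  shows "query_scheme V \<Delta> \<Q>"
proof -
  \<comment> \<open>The conclusion is symmetric in the two graphs, so one claim about an edge
    present in the first and absent from the second serves both ways in which \<open>G\<close> and
    \<open>H\<close> can differ.\<close>
  have sep: "\<exists>Q\<in>\<Q>. \<not> (\<exists>S. maximal_independent_set Q (induced_edges G Q) S \<and>
                          maximal_independent_set Q (induced_edges H Q) S)"
    if G: "simple_graph V G" and H: "simple_graph V H" "max_degree_at_most V H \<Delta>"
      and e: "e \<in> G" "e \<notin> H" for G H e
  proof -
    obtain u v where uv: "e = {u, v}" "u \<noteq> v" "u \<in> V" "v \<in> V"
      using G e(1) unfolding simple_graph_def by (metis card_2_iff insert_subset)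
    define B where "B = {x. {u, x} \<in> H} \<union> {x. {v, x} \<in> H}"
    have nloop: "{x} \<notin> H" for x
      using H(1) by (rule simple_graph_no_loop)
    have "B \<subseteq> V"
      using H(1) by (auto simp: B_def simple_graph_def)
    moreover have "u \<notin> B" "v \<notin> B"
      using e(2) nloop by (auto simp: B_def uv(1) insert_commute)
    ultimately have "B \<subseteq> V - {u, v}"
      by blast
    moreover have "card B \<le> 2 * \<Delta>"
    proof -
      have "card {x. {w, x} \<in> H} \<le> \<Delta>" if "w \<in> V" for w
        using card_neighbours_le_degree[OF simple_graph_finite_edges[OF H(1)], of w] H(2) that
        by (meson le_trans max_degree_at_most_def)
      from this[OF uv(3)] this[OF uv(4)] show ?thesis
        using card_Un_le[of "{x. {u, x} \<in> H}" "{x. {v, x} \<in> H}"] by (simp add: B_def)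
    qed
    ultimately obtain Q where Q: "Q \<in> \<Q>" "u \<in> Q" "v \<in> Q" "Q \<inter> B = {}"
      using isolates_pairsD[OF assms(2) uv(3,4,2)] by metis
    then have "\<not> (\<exists>S. maximal_independent_set Q (induced_edges G Q) S \<and>
                      maximal_independent_set Q (induced_edges H Q) S)"
      using e(1) uv(1) by (intro no_common_maximal_independent_set[of u v]) (auto simp: B_def)
    with Q(1) show ?thesis
      by blast
  qed
  show ?thesis
    unfolding query_scheme_def
  proof (intro conjI allI impI)
    fix G H
    assume *: "simple_graph V G \<and> max_degree_at_most V G \<Delta> \<and>
      simple_graph V H \<and> max_degree_at_most V H \<Delta> \<and> G \<noteq> H"
    then consider e where "e \<in> G" "e \<notin> H" | e where "e \<in> H" "e \<notin> G"
      by blast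
    then show "\<exists>Q\<in>\<Q>. \<not> (\<exists>S. maximal_independent_set Q (induced_edges G Q) S \<and>
                              maximal_independent_set Q (induced_edges H Q) S)"
      using sep[of G H] sep[of H G] * by cases (blast, metis)
  qed (fact assms(1))
qed

section \<open>Necessity: query schemes isolate pairs\<close>

lemma query_schemeD:
  assumes "query_scheme V \<Delta> \<Q>" "simple_graph V G" "max_degree_at_most V G \<Delta>"
    "simple_graph V H" "max_degree_at_most V H \<Delta>" "G \<noteq> H"
  obtains Q where "Q \<in> \<Q>" "Q \<subseteq> V"
    "\<And>S. maximal_independent_set Q (induced_edges G Q) S \<Longrightarrow>
         \<not> maximal_independent_set Q (induced_edges H Q) S"
  using assms unfolding query_scheme_def by (metis PowD subsetD)

text \<open>An extra edge can only destroy independent sets. It spares \<open>S\<close>, which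
  misses one of its ends, and it creates no new competitors above \<open>S\<close>.\<close>

lemma maximal_independent_set_insert_edge:
  assumes "maximal_independent_set V E S" "\<not> (u \<in> S \<and> v \<in> S)"
  shows "maximal_independent_set V (insert {u, v} E) S"
  using assms independent_set_antimono[of V "insert {u, v} E" _ E]
  unfolding maximal_independent_set_def
  by (auto simp: independent_set_def doubleton_eq_iff)

text \<open>This accounts for the number \<open>2 * \<Delta> - 2\<close>: each end of a prospective
  edge takes \<open>\<Delta> - 1\<close> other neighbours and keeps one unit of degree for the edge
  itself.\<close>

lemma ex_balanced_split:
  assumes "finite B" "card B \<le> 2 * k"
  obtains B1 B2 where "B = B1 \<union> B2" "B1 \<inter> B2 = {}" "card B1 \<le> k" "card B2 \<le> k"
proof -
  obtain B1 where B1: "B1 \<subseteq> B" "card B1 = min k (card B)"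
    by (meson min.cobounded2 obtain_subset_with_card_n)
  then have "card (B - B1) = card B - min k (card B)"
    using assms(1) by (simp add: card_Diff_subset finite_subset)
  then show ?thesis
    using B1 assms(2) by (intro that[of B1 "B - B1"]) auto
qed

lemma isolates_pairs_if_query_scheme:
  assumes "finite V" "\<Delta> \<ge> 1" "query_scheme V \<Delta> \<Q>"
  shows "isolates_pairs V (2 * \<Delta> - 2) \<Q>"
  unfolding isolates_pairs_def
proof (intro ballI allI impI, elim conjE)
  fix u v B
  assume uv: "u \<in> V" "v \<in> V" "u \<noteq> v" and B: "B \<subseteq> V - {u, v}" "card B \<le> 2 * \<Delta> - 2"
  have fin: "finite B"
    using B(1) assms(1) by (meson finite_Diff finite_subset)
  moreover have "card B \<le> 2 * (\<Delta> - 1)"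
    using B(2) by simp
  ultimately obtain B1 B2 where split: "B = B1 \<union> B2" "B1 \<inter> B2 = {}"
      and le: "card B1 \<le> \<Delta> - 1" "card B2 \<le> \<Delta> - 1"
    by (rule ex_balanced_split)
  have finB: "finite B1" "finite B2"
    using fin split(1) by auto
  \<comment> \<open>\<open>G\<close> consists of two disjoint stars centred at \<open>u\<close> and
    \<open>v\<close>; the edge \<open>{u, v}\<close> in \<open>H\<close> joins them to a double
    star.\<close>
  define G where "G = (\<lambda>b. {u, b}) ` B1 \<union> (\<lambda>b. {v, b}) ` B2"
  define H where "H = insert {u, v} G"
  have notin: "u \<notin> B" "v \<notin> B"
    using B(1) by auto
  have simple: "simple_graph V H" "simple_graph V G"
    using uv B(1) assms(1) notin
    by (auto simp: simple_graph_def G_def H_def split(1) card_2_iff doubleton_eq_iff)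
  have degree_endpoint: "degree H w \<le> \<Delta>"
    if "{e \<in> H. w \<in> e} \<subseteq> insert {u, v} (f ` C)" "finite C" "card C \<le> \<Delta> - 1"
    for w and f :: "'a \<Rightarrow> 'a set" and C
  proof -
    have "degree H w \<le> card (insert {u, v} (f ` C))"
      unfolding degree_def using that by (intro card_mono) auto
    also have "\<dots> \<le> Suc (card (f ` C))"
      using that(2) by (simp add: card_insert_if)
    also have "\<dots> \<le> \<Delta>"
      using card_image_le[OF that(2), of f] that(3) assms(2) by linarith
    finally show ?thesis .
  qed
  have degree_leaf: "degree H w \<le> \<Delta>" if "{e \<in> H. w \<in> e} \<subseteq> {e0}" for w e0
  proof -
    have "degree H w \<le> card {e0}"
      unfolding degree_def using that by (intro card_mono) auto
    then show ?thesis
      using assms(2) by simp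
  qed
  have degH: "degree H w \<le> \<Delta>" for w
  proof -
    consider "w = u" | "w = v" | "w \<notin> {u, v}" "w \<in> B1" | "w \<notin> {u, v}" "w \<notin> B1"
      by blast
    then show ?thesis
    proof cases
      case 1
      show ?thesis
        by (rule degree_endpoint[of w "\<lambda>b. {u, b}" B1])
          (use 1 notin uv(3) split(1) finB le in \<open>auto simp: H_def G_def\<close>)
    next
      case 2
      show ?thesis
        by (rule degree_endpoint[of w "\<lambda>b. {v, b}" B2])
          (use 2 notin uv(3) split(1) finB le in \<open>auto simp: H_def G_def\<close>)
    next
      case 3
      show ?thesis
        by (rule degree_leaf[of w "{u, w}"]) (use 3 split in \<open>auto simp: H_def G_def\<close>)
    next
      \<comment> \<open>Apart from the centres, a vertex outside \<open>B1\<close> is a leaf at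
        \<open>v\<close> or isolated; either way \<open>{v, w}\<close> is its only possible
        edge.\<close>
      case 4
      show ?thesis
        by (rule degree_leaf[of w "{v, w}"]) (use 4 split in \<open>auto simp: H_def G_def\<close>)
    qed
  qed
  have degG: "degree G w \<le> \<Delta>" for w
    by (rule order_trans[OF degree_mono[OF simple_graph_finite_edges[OF simple(1)]] degH])
      (auto simp: H_def)
  have "{u, v} \<notin> G"
    using notin split(1) uv(3) by (auto simp: G_def doubleton_eq_iff)
  then have "G \<noteq> H"
    by (auto simp: H_def)
  then obtain Q where Q: "Q \<in> \<Q>" "Q \<subseteq> V"
    and none: "\<And>S. maximal_independent_set Q (induced_edges G Q) S \<Longrightarrow>
         \<not> maximal_independent_set Q (induced_edges H Q) S"
    using query_schemeD[OF assms(3) simple(2) _ simple(1)] degG degH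
    unfolding max_degree_at_most_def by metis
  have finQ: "finite Q"
    using Q(2) assms(1) by (rule finite_subset)
  \<comment> \<open>A maximal independent set that omits an end of \<open>{u, v}\<close> would
    answer the query for both graphs, which \<open>none\<close> forbids.\<close>
  have both: "u \<in> S \<and> v \<in> S" if "maximal_independent_set Q (induced_edges G Q) S" for S
  proof (rule ccontr)
    assume not: "\<not> (u \<in> S \<and> v \<in> S)"
    have "induced_edges H Q = induced_edges G Q \<or>
          induced_edges H Q = insert {u, v} (induced_edges G Q)"
      by (auto simp: induced_edges_def H_def)
    then have "maximal_independent_set Q (induced_edges H Q) S"
      using maximal_independent_set_insert_edge[OF that not] that by auto
    with none[OF that] show False ..
  qed
  \<comment> \<open>\<open>T\<close> stands for \<open>{}\<close> or a singleton, both independent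
    in a loopless graph. The former serves to place \<open>u\<close> and \<open>v\<close> in
    \<open>Q\<close>, the latter to keep \<open>B\<close> out of \<open>Q\<close>.\<close>
  have indep: "\<exists>S. T \<subseteq> S \<and> maximal_independent_set Q (induced_edges G Q) S"
    if "T \<subseteq> {b}" "T \<subseteq> Q" for T b
  proof (rule ex_maximal_independent_set[OF finQ])
    have "T = {} \<or> T = {b}"
      using that(1) by blast
    then show "independent_set Q (induced_edges G Q) T"
      using that(2) simple_graph_no_loop[OF simple(2)]
      by (auto simp: independent_set_def induced_edges_def)
  qed
  have sub: "S \<subseteq> Q" if "maximal_independent_set Q (induced_edges G Q) S" for S
    using that by (auto simp: maximal_independent_set_def independent_set_def)
  have "u \<in> Q" "v \<in> Q"
    using indep[of "{}"] both sub by blast+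
  \<comment> \<open>By \<open>both\<close>, a maximal independent set through \<open>b\<close> also
    contains \<open>u\<close> and \<open>v\<close>, yet every vertex of \<open>B\<close> is adjacent
    in \<open>G\<close> to one of them.\<close>
  moreover have "b \<notin> B" if b: "b \<in> Q" for b
  proof
    assume "b \<in> B"
    obtain S where S: "b \<in> S" "maximal_independent_set Q (induced_edges G Q) S"
      using indep[of "{b}" b] b by auto
    then have "{u, b} \<notin> induced_edges G Q" "{v, b} \<notin> induced_edges G Q"
      using both[OF S(2)] by (auto simp: maximal_independent_set_def independent_set_def)
    then show False
      using \<open>b \<in> B\<close> \<open>u \<in> Q\<close> \<open>v \<in> Q\<close> b split(1) by (auto simp: induced_edges_def G_def)
  qed
  ultimately show "\<exists>Q\<in>\<Q>. u \<in> Q \<and> v \<in> Q \<and> Q \<inter> B = {}"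
    using Q(1) by blast
qed

section \<open>Distinct vertices have distinct duals\<close>

lemma maximal_independent_set_edgeless: "maximal_independent_set V {} V"
  by (auto simp: maximal_independent_set_def independent_set_def)

lemma maximal_independent_set_single_edge:
  assumes "u \<in> V" "u \<noteq> w"
  shows "maximal_independent_set V {{u, w}} (V - {w})"
  using assms
  by (auto simp: maximal_independent_set_def independent_set_def doubleton_eq_iff)

text \<open>
  For \<open>\<Delta> = 1\<close> this is not a consequence of the isolation of pairs. A query that does not tell \<open>u\<close>
  from \<open>v\<close> cannot tell the edges \<open>{u, w}\<close> and \<open>{v, w}\<close> apart either.
\<close>

lemma inj_on_dual:
  assumes "finite V" "card V \<ge> 3" "\<Delta> \<ge> 1" "query_scheme V \<Delta> \<Q>"
  shows "inj_on (dual \<Q>) V"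
proof (rule inj_onI, rule ccontr)
  fix u v
  assume uv: "u \<in> V" "v \<in> V" "dual \<Q> u = dual \<Q> v" "u \<noteq> v"
  have same: "u \<in> Q \<longleftrightarrow> v \<in> Q" if "Q \<in> \<Q>" for Q
    using uv(3) that by (auto simp: dual_def)
  have "card {u, v} < card V"
    using uv(4) assms(2) by simp
  then obtain w where w: "w \<in> V" "w \<noteq> u" "w \<noteq> v"
    by (metis card_mono finite.emptyI finite_insert insertCI leD subsetI)
  have "simple_graph V {{x, w}}" "max_degree_at_most V {{x, w}} \<Delta>" if "x \<in> V" "x \<noteq> w" for x
  proof -
    have "degree {{x, w}} y \<le> card {{x, w}}" for y
      unfolding degree_def by (rule card_mono) auto
    then show "max_degree_at_most V {{x, w}} \<Delta>"
      using assms(3) by (auto simp: max_degree_at_most_def intro: order_trans)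
  qed (use that w assms(1) in \<open>auto simp: simple_graph_def\<close>)
  moreover have "{{u, w}} \<noteq> {{v, w}}"
    using uv(4) by (auto simp: doubleton_eq_iff)
  ultimately obtain Q where Q: "Q \<in> \<Q>"
    and none: "\<And>S. maximal_independent_set Q (induced_edges {{u, w}} Q) S \<Longrightarrow>
         \<not> maximal_independent_set Q (induced_edges {{v, w}} Q) S"
    using query_schemeD[OF assms(4), of "{{u, w}}" "{{v, w}}"] uv(1,2) w(2,3) by metis
  show False
  proof (cases "u \<in> Q \<and> w \<in> Q")
    case True
    then have "induced_edges {{u, w}} Q = {{u, w}}" "induced_edges {{v, w}} Q = {{v, w}}"
      using same[OF Q] by (auto simp: induced_edges_def)
    \<comment> \<open>The two edges share the end \<open>w\<close>, so removing \<open>w\<close>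
      alone gives a maximal independent set of both induced subgraphs.\<close>
    then show False
      using none[of "Q - {w}"] maximal_independent_set_single_edge[of _ Q w] True same[OF Q] w
      by metis
  next
    \<comment> \<open>The edges lie inside \<open>Q\<close> together or not at all; here neither
      does, and \<open>Q\<close> itself is the common answer.\<close>
    case False
    then have "induced_edges {{u, w}} Q = {}" "induced_edges {{v, w}} Q = {}"
      using same[OF Q] by (auto simp: induced_edges_def)
    then show False
      using none[of Q] maximal_independent_set_edgeless[of Q] by simp
  qed
qed

subsection \<open>Cover-free families\<close>

lemma cover_free_imp_distinct: "cover_free w r \<F> \<Longrightarrow> cover_free_distinct w r \<F>"
  unfolding cover_free_def cover_free_distinct_def by (elim all_forward imp_forward) simp_all

lemma atLeastAtMost_1_2: "{Suc 0..2} = {Suc 0, 2}"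
  by (simp add: numeral_2_eq_2 atLeastAtMostSuc_conv insert_commute)

text \<open>An indexed \<open>B\<close> may repeat members, so its range is a set of at most
  \<open>r\<close> members; passing to such sets removes the indices. The case \<open>X = Y\<close>
  is included because \<open>A\<close> may repeat as well.\<close>

lemma cover_free_2I:
  assumes "\<And>X Y \<B>. X \<in> \<F> \<Longrightarrow> Y \<in> \<F> \<Longrightarrow> \<B> \<subseteq> \<F> - {X, Y} \<Longrightarrow> finite \<B> \<Longrightarrow> card \<B> \<le> r \<Longrightarrow>
    \<not> X \<inter> Y \<subseteq> \<Union>\<B>"
  shows "cover_free 2 r \<F>"
  unfolding cover_free_def
proof (intro allI impI, elim conjE)
  fix A B :: "nat \<Rightarrow> 'a set"
  assume *: "A ` {1..2} \<subseteq> \<F>" "B ` {1..r} \<subseteq> \<F> - A ` {1..2}"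
  have "\<not> A 1 \<inter> A 2 \<subseteq> \<Union>(B ` {1..r})"
    using * card_image_le[of "{1..r}" B] by (intro assms) (auto simp: atLeastAtMost_1_2)
  then show "\<not> \<Inter>(A ` {1..2}) \<subseteq> \<Union>(B ` {1..r})"
    by (simp add: atLeastAtMost_1_2)
qed

lemma cover_free_distinct_2I:
  assumes "\<And>X Y \<B>. X \<in> \<F> \<Longrightarrow> Y \<in> \<F> \<Longrightarrow> X \<noteq> Y \<Longrightarrow> \<B> \<subseteq> \<F> - {X, Y} \<Longrightarrow> finite \<B> \<Longrightarrow>
    card \<B> \<le> r \<Longrightarrow> \<not> X \<inter> Y \<subseteq> \<Union>\<B>"
  shows "cover_free_distinct 2 r \<F>"
  unfolding cover_free_distinct_def
proof (intro allI impI, elim conjE)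
  fix A B :: "nat \<Rightarrow> 'a set"
  assume *: "inj_on A {1..2}" "A ` {1..2} \<subseteq> \<F>" "B ` {1..r} \<subseteq> \<F> - A ` {1..2}"
  have "\<not> A 1 \<inter> A 2 \<subseteq> \<Union>(B ` {1..r})"
    using * card_image_le[of "{1..r}" B] by (intro assms) (auto simp: atLeastAtMost_1_2)
  then show "\<not> \<Inter>(A ` {1..2}) \<subseteq> \<Union>(B ` {1..r})"
    by (simp add: atLeastAtMost_1_2)
qed

text \<open>Surplus indices are all sent to one fixed element, which is why \<open>S\<close> has to
  be nonempty.\<close>

lemma ex_enumeration_with_repetition:
  assumes "finite S" "S \<noteq> {}" "card S \<le> r"
  shows "\<exists>B :: nat \<Rightarrow> 'b. B ` {1..r} = S"
proof -
  obtain B where B: "bij_betw B {1..card S} S"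
    using ex_bij_betw_nat_finite_1[OF assms(1)] by blast
  obtain s where "s \<in> S"
    using assms(2) by blast
  have im: "B ` {1..card S} = S"
    using B by (rule bij_betw_imp_surj_on)
  define C where "C i = (if i \<le> card S then B i else s)" for i
  have "C i \<in> S" if "i \<in> {1..r}" for i
    using that im \<open>s \<in> S\<close> by (auto simp: C_def)
  moreover have "S \<subseteq> C ` {1..r}"
  proof
    fix x assume "x \<in> S"
    then obtain i where "i \<in> {1..card S}" "x = B i"
      using im by blast
    then show "x \<in> C ` {1..r}"
      using assms(3) by (intro image_eqI[of _ _ i]) (auto simp: C_def)
  qed
  ultimately show ?thesis
    by blast
qed

text \<open>Partial converse of \<open>cover_free_distinct_2I\<close>: for positive \<open>r\<close>
  an enumeration over \<open>{1..r}\<close> has nonempty range, so the empty \<open>\<B>\<close> is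
  out of reach.\<close>

lemma cover_free_distinct_2D:
  assumes "cover_free_distinct 2 r \<F>" "X \<in> \<F>" "Y \<in> \<F>" "X \<noteq> Y"
    "\<B> \<subseteq> \<F> - {X, Y}" "finite \<B>" "\<B> \<noteq> {}" "card \<B> \<le> r"
  shows "\<not> X \<inter> Y \<subseteq> \<Union>\<B>"
proof -
  obtain B :: "nat \<Rightarrow> _" where B: "B ` {1..r} = \<B>"
    using ex_enumeration_with_repetition[OF assms(6-8)] by blast
  define A where "A i = (if i = 1 then X else Y)" for i :: nat
  have A: "inj_on A {1..2}" "A ` {1..2} = {X, Y}"
    using assms(4) by (auto simp: atLeastAtMost_1_2 A_def)
  moreover have "A ` {1..2} \<subseteq> \<F>" "B ` {1..r} \<subseteq> \<F> - A ` {1..2}"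
    unfolding A(2) B using assms(2,3,5) by auto
  ultimately have "\<not> \<Inter>(A ` {1..2}) \<subseteq> \<Union>(B ` {1..r})"
    using assms(1) unfolding cover_free_distinct_def by metis
  then show ?thesis
    unfolding A(2) B by simp
qed

section \<open>Relabelling the points; the minima are attained\<close>

lemma ex_relabelling:
  assumes "finite P" "\<F> \<subseteq> Pow P"
  shows "\<exists>\<G> \<subseteq> Pow {1..card P}. card \<G> = card \<F> \<and>
    (cover_free 2 r \<F> \<longrightarrow> cover_free 2 r \<G>) \<and>
    (cover_free_distinct 2 r \<F> \<longrightarrow> cover_free_distinct 2 r \<G>)"
proof -
  obtain h where h: "bij_betw h P {1..card P}"
    using ex_bij_betw_finite_nat[OF assms(1)] ex_bij_betw_nat_finite_1[OF assms(1)]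
      bij_betw_inv by blast
  define \<G> where "\<G> = (`) h ` \<F>"
  \<comment> \<open>Preimage under \<open>h\<close> inverts the image map on \<open>\<F>\<close> and
    respects unions and intersections, so a violation of cover-freeness in \<open>\<G>\<close> pulls
    back to one in \<open>\<F>\<close>.\<close>
  define g where "g X = {p \<in> P. h p \<in> X}" for X
  have gh: "g (h ` X) = X" if "X \<in> \<F>" for X
    using that assms(2) h by (auto simp: g_def bij_betw_def inj_on_def)
  have gG: "g X \<in> \<F>" if "X \<in> \<G>" for X
    using that gh by (auto simp: \<G>_def)
  have inj: "X = Y" if "g X = g Y" "X \<in> \<G>" "Y \<in> \<G>" for X Y
    using that gh by (auto simp: \<G>_def)
  have pull: "(g \<circ> A) ` {1..2} \<subseteq> \<F>" "(g \<circ> B) ` {1..r} \<subseteq> \<F> - (g \<circ> A) ` {1..2}"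
      "inj_on A {1..2} \<Longrightarrow> inj_on (g \<circ> A) {1..2}"
      "\<Inter>(A ` {1..2}) \<subseteq> \<Union>(B ` {1..r}) \<Longrightarrow> \<Inter>((g \<circ> A) ` {1..2}) \<subseteq> \<Union>((g \<circ> B) ` {1..r})"
    if A: "A ` {1..2} \<subseteq> \<G>" and B: "B ` {1..r} \<subseteq> \<G> - A ` {1..2}" for A B :: "nat \<Rightarrow> _"
  proof -
    show "(g \<circ> A) ` {1..2} \<subseteq> \<F>"
      using A gG by auto
    show "(g \<circ> B) ` {1..r} \<subseteq> \<F> - (g \<circ> A) ` {1..2}"
    proof
      fix x assume "x \<in> (g \<circ> B) ` {1..r}"
      then obtain i where i: "i \<in> {1..r}" "x = g (B i)"
        by auto
      then have "B i \<in> \<G> - A ` {1..2}"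
        using B by blast
      then have Bi: "B i \<in> \<G>" "B i \<notin> A ` {1..2}"
        by blast+
      have "g (B i) \<noteq> g (A j)" if "j \<in> {1..2}" for j
        using inj[of "B i" "A j"] Bi A that by blast
      then show "x \<in> \<F> - (g \<circ> A) ` {1..2}"
        using gG[OF Bi(1)] unfolding i(2) image_comp[symmetric] by blast
    qed
    show "inj_on (g \<circ> A) {1..2}" if "inj_on A {1..2}"
      using that A inj[of "A 1" "A 2"] by (auto simp: atLeastAtMost_1_2)
    show "\<Inter>((g \<circ> A) ` {1..2}) \<subseteq> \<Union>((g \<circ> B) ` {1..r})"
      if "\<Inter>(A ` {1..2}) \<subseteq> \<Union>(B ` {1..r})"
      using that by (auto simp: atLeastAtMost_1_2 g_def)
  qed
  have "\<G> \<subseteq> Pow {1..card P}"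
    using assms(2) h by (auto simp: \<G>_def bij_betw_def)
  moreover have "card \<G> = card \<F>"
    unfolding \<G>_def by (rule card_image) (metis inj_onI gh)
  moreover have "cover_free 2 r \<G>" if "cover_free 2 r \<F>"
    unfolding cover_free_def
  proof (intro allI impI notI, elim conjE)
    fix A B :: "nat \<Rightarrow> nat set"
    assume *: "A ` {1..2} \<subseteq> \<G>" "B ` {1..r} \<subseteq> \<G> - A ` {1..2}" "\<Inter>(A ` {1..2}) \<subseteq> \<Union>(B ` {1..r})"
    note p = pull[OF *(1,2)]
    show False
      using that[unfolded cover_free_def, rule_format, OF conjI, OF p(1,2)] p(4)[OF *(3)] ..
  qed
  moreover have "cover_free_distinct 2 r \<G>" if "cover_free_distinct 2 r \<F>"
    unfolding cover_free_distinct_def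
  proof (intro allI impI notI, elim conjE)
    fix A B :: "nat \<Rightarrow> nat set"
    assume inj: "inj_on A {1..2}" and *: "A ` {1..2} \<subseteq> \<G>" "B ` {1..r} \<subseteq> \<G> - A ` {1..2}"
      "\<Inter>(A ` {1..2}) \<subseteq> \<Union>(B ` {1..r})"
    note p = pull[OF *(1,2)]
    show False
      using that[unfolded cover_free_distinct_def, rule_format, OF conjI, OF p(3)[OF inj] conjI, OF p(1,2)]
        p(4)[OF *(3)] ..
  qed
  ultimately show ?thesis
    by blast
qed

lemma t_cff_le:
  assumes "finite P" "\<F> \<subseteq> Pow P" "card \<F> = n" "cover_free 2 r \<F>"
  shows "t_cff n 2 r \<le> card P"
proof -
  obtain \<G> where "\<G> \<subseteq> Pow {1..card P}" "card \<G> = n" "cover_free 2 r \<G>"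
    using ex_relabelling[OF assms(1,2), of r] assms(3,4) by blast
  then show ?thesis
    unfolding t_cff_def by (intro Least_le) blast
qed

lemma t_cff_distinct_le:
  assumes "finite P" "\<F> \<subseteq> Pow P" "card \<F> = n" "cover_free_distinct 2 r \<F>"
  shows "t_cff_distinct n 2 r \<le> card P"
proof -
  obtain \<G> where "\<G> \<subseteq> Pow {1..card P}" "card \<G> = n" "cover_free_distinct 2 r \<G>"
    using ex_relabelling[OF assms(1,2), of r] assms(3,4) by blast
  then show ?thesis
    unfolding t_cff_distinct_def by (intro Least_le) blast
qed

text \<open>Points are the subsets of \<open>{1..n}\<close>, and member \<open>i\<close> collects
  those containing \<open>i\<close>. The point \<open>{i, j}\<close> then lies in the members
  \<open>i\<close> and \<open>j\<close> only. Existence makes the \<open>LEAST\<close> in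
  \<open>t_cff\<close> meaningful.\<close>

lemma ex_cover_free: "\<exists>t :: nat. \<exists>\<F> \<subseteq> Pow {1..t}. card \<F> = n \<and> cover_free 2 r \<F>"
proof -
  define f where "f i = {S \<in> Pow {1..n}. i \<in> S}" for i
  define \<F> where "\<F> = f ` {1..n}"
  have "inj_on f {1..n}"
  proof (rule inj_onI)
    fix i j assume "i \<in> {1..n}" "f i = f j"
    moreover from this(1) have "{i} \<in> f i"
      by (simp add: f_def)
    ultimately have "{i} \<in> f j"
      by simp
    then show "i = j"
      by (simp add: f_def)
  qed
  then have card: "card \<F> = n"
    by (simp add: \<F>_def card_image)
  have "cover_free 2 r \<F>"
  proof (rule cover_free_2I)
    fix X Y \<B>
    assume "X \<in> \<F>" "Y \<in> \<F>" and \<B>: "\<B> \<subseteq> \<F> - {X, Y}"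
    then obtain i j where ij: "i \<in> {1..n}" "j \<in> {1..n}" "X = f i" "Y = f j"
      by (auto simp: \<F>_def)
    have "{i, j} \<in> X \<inter> Y"
      using ij by (auto simp: f_def)
    moreover have "{i, j} \<notin> \<Union>\<B>"
    proof
      assume "{i, j} \<in> \<Union>\<B>"
      then obtain Z where "Z \<in> \<B>" "{i, j} \<in> Z"
        by blast
      moreover from this obtain k where "Z = f k"
        using \<B> by (auto simp: \<F>_def)
      ultimately show False
        using \<B> ij(3,4) by (auto simp: f_def)
    qed
    ultimately show "\<not> X \<inter> Y \<subseteq> \<Union>\<B>"
      by blast
  qed
  moreover have "\<F> \<subseteq> Pow (Pow {1..n})"
    by (auto simp: \<F>_def f_def)
  moreover have "finite (Pow {1..n})"
    by simp
  ultimately obtain \<G> where "\<G> \<subseteq> Pow {1..card (Pow {1..n})}" "card \<G> = n" "cover_free 2 r \<G>"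
    using ex_relabelling[of "Pow {1..n}" \<F> r] card by metis
  then show ?thesis
    by (intro exI conjI)
qed

lemma t_cff_attained: "\<exists>\<F> \<subseteq> Pow {1..t_cff n 2 r}. card \<F> = n \<and> cover_free 2 r \<F>"
  unfolding t_cff_def by (rule LeastI_ex) (rule ex_cover_free)

lemma t_cff_distinct_attained:
  "\<exists>\<F> \<subseteq> Pow {1..t_cff_distinct n 2 r}. card \<F> = n \<and> cover_free_distinct 2 r \<F>"
  unfolding t_cff_distinct_def
  by (rule LeastI_ex) (metis ex_cover_free[of n r] cover_free_imp_distinct)

text \<open>The condition is vacuous: either there are too few members for \<open>w\<close> distinct
  \<open>A i\<close>, or these exhaust the family and leave no choice for
  \<open>B 1\<close>.\<close>

lemma cover_free_distinct_small:
  assumes "finite \<F>" "card \<F> < w \<or> card \<F> \<le> w \<and> r > 0"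
  shows "cover_free_distinct w r \<F>"
  unfolding cover_free_distinct_def
proof (intro allI impI, elim conjE)
  fix A B :: "nat \<Rightarrow> 'a set"
  assume *: "inj_on A {1..w}" "A ` {1..w} \<subseteq> \<F>" "B ` {1..r} \<subseteq> \<F> - A ` {1..w}"
  have "card (A ` {1..w}) = w"
    using card_image[OF *(1)] by simp
  moreover from this have "w \<le> card \<F>"
    using card_mono[OF assms(1) *(2)] by simp
  ultimately have "A ` {1..w} = \<F>" "r > 0"
    using assms card_subset_eq[OF assms(1) *(2)] by auto
  then have "B 1 \<in> {}"
    using *(3) by auto
  then show "\<not> \<Inter>(A ` {1..w}) \<subseteq> \<Union>(B ` {1..r})"
    by simp
qed

subsection \<open>The two bounds\<close>

lemma min_queries_le:
  assumes "query_scheme V \<Delta> \<Q>"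
  shows "min_queries V \<Delta> \<le> card \<Q>"
  unfolding min_queries_def using assms by (intro Least_le) auto

lemma min_queries_attained:
  assumes "finite V"
  obtains \<Q> where "query_scheme V \<Delta> \<Q>" "card \<Q> = min_queries V \<Delta>" "finite \<Q>"
proof -
  have "isolates_pairs V (2 * \<Delta>) (Pow V)"
    unfolding isolates_pairs_def
  proof (intro ballI allI impI)
    fix u v B
    assume "u \<in> V" "v \<in> V" "u \<noteq> v \<and> B \<subseteq> V - {u, v} \<and> card B \<le> 2 * \<Delta>"
    then show "\<exists>Q\<in>Pow V. u \<in> Q \<and> v \<in> Q \<and> Q \<inter> B = {}"
      by (intro bexI[of _ "{u, v}"]) auto
  qed
  then have "\<exists>m. \<exists>\<Q>. query_scheme V \<Delta> \<Q> \<and> card \<Q> = m"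
    using query_scheme_if_isolates_pairs[OF subset_refl] by blast
  then have "\<exists>\<Q>. query_scheme V \<Delta> \<Q> \<and> card \<Q> = min_queries V \<Delta>"
    unfolding min_queries_def by (rule LeastI_ex)
  moreover have "finite \<Q>" if "query_scheme V \<Delta> \<Q>" for \<Q>
    using that assms unfolding query_scheme_def by (meson finite_Pow_iff finite_subset)
  ultimately show ?thesis
    using that by blast
qed

section \<open>Upper bound: from cover-free families to query schemes\<close>

lemma min_queries_le_if_cover_free_distinct:
  assumes "finite V" "\<Delta> \<ge> 1" "\<F> \<subseteq> Pow {1..t}" "card \<F> = card V"
    "cover_free_distinct 2 (2 * \<Delta>) \<F>"
  shows "min_queries V \<Delta> \<le> t"
proof -
  consider "card V \<le> 1" | "card V = 2" | "card V \<ge> 3"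
    by linarith
  then show ?thesis
  proof cases
    case 1
    then have "isolates_pairs V (2 * \<Delta>) {}"
      using assms(1) by (auto simp: isolates_pairs_def card_le_Suc0_iff_eq)
    then show ?thesis
      using min_queries_le[OF query_scheme_if_isolates_pairs[of "{}" V \<Delta>]] by simp
  next
    \<comment> \<open>For two members cover-freeness is vacuous here, so the one point needed comes
      from counting: an empty ground set has only one subset.\<close>
    case 2
    then obtain a b where V: "V = {a, b}"
      by (meson card_2_iff)
    have "isolates_pairs V (2 * \<Delta>) {V}"
      by (auto simp: isolates_pairs_def V)
    then have "min_queries V \<Delta> \<le> 1"
      using min_queries_le[OF query_scheme_if_isolates_pairs[of "{V}" V \<Delta>]] by simp
    moreover have "t \<noteq> 0"
    proof
      assume "t = 0"
      then have "card \<F> \<le> card {{} :: nat set}"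
        using assms(3) by (intro card_mono) auto
      with 2 assms(4) show False
        by simp
    qed
    ultimately show ?thesis
      by simp
  next
    case 3
    have "finite \<F>"
      using assms(3) by (rule finite_subset) simp
    then obtain f where f: "bij_betw f V \<F>"
      using finite_same_card_bij[OF assms(1)] assms(4) by metis
    \<comment> \<open>Dualizing back: points of the ground set become queries.\<close>
    define q where "q i = {v \<in> V. i \<in> f v}" for i
    have inj: "f x = f y \<Longrightarrow> x \<in> V \<Longrightarrow> y \<in> V \<Longrightarrow> x = y" for x y
      using f by (auto simp: bij_betw_def inj_on_def)
    have mem: "f x \<in> \<F>" if "x \<in> V" for x
      using f that by (auto simp: bij_betw_def)
    have "isolates_pairs V (2 * \<Delta>) (q ` {1..t})"
      unfolding isolates_pairs_def
    proof (intro ballI allI impI, elim conjE)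
      fix u v B
      assume uv: "u \<in> V" "v \<in> V" "u \<noteq> v" and B: "B \<subseteq> V - {u, v}" "card B \<le> 2 * \<Delta>"
      have "card {u, v} < card V"
        using uv(3) 3 by simp
      then obtain w where w: "w \<in> V" "w \<noteq> u" "w \<noteq> v"
        by (metis card_mono finite.emptyI finite_insert insertCI leD subsetI)
      \<comment> \<open>\<open>cover_free_distinct_2D\<close> asks for a nonempty set of further
        members, so an empty \<open>B\<close> is replaced by a third vertex; the size bound then
        uses \<open>\<Delta> \<ge> 1\<close>.\<close>
      define C where "C = (if B = {} then {w} else B)"
      have C: "C \<subseteq> V - {u, v}" "C \<noteq> {}" "card C \<le> 2 * \<Delta>" "B \<subseteq> C"
        using B w assms(2) by (auto simp: C_def)
      have finC: "finite C"
        using C(1) assms(1) by (meson finite_Diff finite_subset)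
      have "f ` C \<subseteq> \<F> - {f u, f v}"
        using C(1) inj[of _ u] inj[of _ v] uv mem by auto
      moreover have "f u \<noteq> f v"
        using inj uv by blast
      moreover have "card (f ` C) \<le> 2 * \<Delta>"
        using card_image_le[OF finC, of f] C(3) by linarith
      ultimately have "\<not> f u \<inter> f v \<subseteq> \<Union>(f ` C)"
        using cover_free_distinct_2D[OF assms(5) mem[OF uv(1)] mem[OF uv(2)]] finC C(2) by blast
      then obtain i where i: "i \<in> f u" "i \<in> f v" "\<And>b. b \<in> B \<Longrightarrow> i \<notin> f b"
        using C(4) by blast
      moreover have "i \<in> {1..t}"
        using i(1) mem[OF uv(1)] assms(3) by blast
      ultimately show "\<exists>Q\<in>q ` {1..t}. u \<in> Q \<and> v \<in> Q \<and> Q \<inter> B = {}"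
        using uv by (intro bexI[of _ "q i"]) (auto simp: q_def)
    qed
    moreover have "q ` {1..t} \<subseteq> Pow V"
      by (auto simp: q_def)
    ultimately have "min_queries V \<Delta> \<le> card (q ` {1..t})"
      by (intro min_queries_le query_scheme_if_isolates_pairs)
    also have "\<dots> \<le> t"
      using card_image_le[of "{1..t}" q] by simp
    finally show ?thesis .
  qed
qed

section \<open>Lower bound: duals of query schemes\<close>

lemma dual_not_covered:
  assumes "isolates_pairs V r \<Q>" "u \<in> V" "v \<in> V" "u \<noteq> v" "C \<subseteq> V" "card C \<le> r"
    "dual \<Q> u \<notin> dual \<Q> ` C" "dual \<Q> v \<notin> dual \<Q> ` C"
  shows "\<not> dual \<Q> u \<inter> dual \<Q> v \<subseteq> \<Union>(dual \<Q> ` C)"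
proof -
  have "C \<subseteq> V - {u, v}"
    using assms(5,7,8) by auto
  from isolates_pairsD[OF assms(1-4) this assms(6)] obtain Q where
    \<comment> \<open>Seen as a point of the dual family, the isolating query lies in the duals of
      \<open>u\<close> and \<open>v\<close> and in none of those of \<open>C\<close>.\<close>
    Q: "Q \<in> \<Q>" "u \<in> Q" "v \<in> Q" "Q \<inter> C = {}" .
  then have "Q \<in> dual \<Q> u \<inter> dual \<Q> v"
    by (simp add: dual_def)
  moreover have "Q \<notin> \<Union>(dual \<Q> ` C)"
    using Q(4) by (auto simp: dual_def)
  ultimately show ?thesis
    by blast
qed

text \<open>One vertex is chosen per member, so a bound on the number of members carries over to the
  vertices that a query has to miss.\<close>

lemma ex_index_set:
  assumes "\<B> \<subseteq> f ` V" "finite \<B>"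
  shows "\<exists>C \<subseteq> V. f ` C = \<B> \<and> card C = card \<B>"
  using assms by (metis card_image subset_image_inj)

lemma cover_free_distinct_dual:
  assumes "isolates_pairs V r \<Q>"
  shows "cover_free_distinct 2 r (dual \<Q> ` V)"
proof (rule cover_free_distinct_2I)
  fix X Y \<B>
  assume *: "X \<in> dual \<Q> ` V" "Y \<in> dual \<Q> ` V" "X \<noteq> Y" "\<B> \<subseteq> dual \<Q> ` V - {X, Y}" "finite \<B>"
    "card \<B> \<le> r"
  obtain u v where uv: "u \<in> V" "v \<in> V" "X = dual \<Q> u" "Y = dual \<Q> v"
    using *(1,2) by blast
  obtain C where C: "C \<subseteq> V" "dual \<Q> ` C = \<B>" "card C = card \<B>"
    using ex_index_set[of \<B> "dual \<Q>" V] *(4,5) by auto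
  have "u \<noteq> v" "card C \<le> r" "dual \<Q> u \<notin> dual \<Q> ` C" "dual \<Q> v \<notin> dual \<Q> ` C"
    using uv(3,4) *(3,4,6) C(2,3) by auto
  then show "\<not> X \<inter> Y \<subseteq> \<Union>\<B>"
    using dual_not_covered[OF assms uv(1,2) _ C(1)] unfolding uv(3,4) C(2) by blast
qed

text \<open>
  When the two members coincide, the vertex bound leaves room for a second vertex that is not among
  the \<open>r\<close> others.
\<close>

lemma cover_free_dual:
  assumes "finite V" "isolates_pairs V r \<Q>" "inj_on (dual \<Q>) V" "r + 2 \<le> card V"
  shows "cover_free 2 r (dual \<Q> ` V)"
proof (rule cover_free_2I)
  fix X Y \<B>
  assume *: "X \<in> dual \<Q> ` V" "Y \<in> dual \<Q> ` V" "\<B> \<subseteq> dual \<Q> ` V - {X, Y}" "finite \<B>" "card \<B> \<le> r"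
  obtain u v where uv: "u \<in> V" "v \<in> V" "X = dual \<Q> u" "Y = dual \<Q> v"
    using *(1,2) by blast
  obtain C where C: "C \<subseteq> V" "dual \<Q> ` C = \<B>" "card C = card \<B>"
    using ex_index_set[of \<B> "dual \<Q>" V] *(3,4) by auto
  have notin: "dual \<Q> u \<notin> dual \<Q> ` C" "dual \<Q> v \<notin> dual \<Q> ` C" and le: "card C \<le> r"
    using uv(3,4) *(3,5) C(2,3) by auto
  show "\<not> X \<inter> Y \<subseteq> \<Union>\<B>"
  proof (cases "u = v")
    case False
    then show ?thesis
      using dual_not_covered[OF assms(2) uv(1,2) _ C(1) le notin] unfolding uv(3,4) C(2) by blast
  next
    case True
    have "finite C"
      using C(1) assms(1) by (rule finite_subset)
    then have "card (insert u C) < card V" "finite (insert u C)"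
      using le assms(4) by (auto simp: card_insert_if)
    then obtain w where w: "w \<in> V" "w \<noteq> u" "w \<notin> C"
      by (metis card_mono insertCI leD subsetI)
    have "dual \<Q> w \<notin> dual \<Q> ` C"
      using w C(1) inj_on_image_mem_iff[OF assms(3)] by blast
    \<comment> \<open>If even the intersection with \<open>dual \<Q> w\<close> is not covered, then
      neither is \<open>dual \<Q> u\<close> alone.\<close>
    then have "\<not> dual \<Q> u \<inter> dual \<Q> w \<subseteq> \<Union>(dual \<Q> ` C)"
      using dual_not_covered[OF assms(2) uv(1) w(1) _ C(1) le notin(1)] w(2) by blast
    then show ?thesis
      using True unfolding uv(3,4) C(2) by blast
  qed
qed

lemma dual_subset_Pow: "dual \<Q> ` V \<subseteq> Pow \<Q>"
  by (auto simp: dual_def)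

theorem lemma1p6:
  fixes V :: "'a set" and n \<Delta> :: nat
  assumes "finite V" and "card V = n" and "\<Delta> \<ge> 1"
  shows "(\<not> (n = 2 \<and> \<Delta> = 1) \<longrightarrow> t_cff_distinct n 2 (2 * \<Delta> - 2) \<le> min_queries V \<Delta>) \<and>
         min_queries V \<Delta> \<le> t_cff_distinct n 2 (2 * \<Delta>) \<and>
         (n \<ge> 3 \<and> n \<ge> 2 * \<Delta> \<longrightarrow> t_cff n 2 (2 * \<Delta> - 2) \<le> min_queries V \<Delta>) \<and>
         min_queries V \<Delta> \<le> t_cff n 2 (2 * \<Delta>)"
proof (intro conjI impI)
  obtain \<Q> where \<Q>: "query_scheme V \<Delta> \<Q>" "card \<Q> = min_queries V \<Delta>" "finite \<Q>"
    by (rule min_queries_attained[OF assms(1)])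
  have iso: "isolates_pairs V (2 * \<Delta> - 2) \<Q>"
    by (rule isolates_pairs_if_query_scheme[OF assms(1,3) \<Q>(1)])
  have card_dual: "card (dual \<Q> ` V) = n" if "n \<ge> 3"
    using inj_on_dual[OF assms(1) _ assms(3) \<Q>(1)] that assms(2) by (simp add: card_image)
  show "t_cff_distinct n 2 (2 * \<Delta> - 2) \<le> min_queries V \<Delta>" if "\<not> (n = 2 \<and> \<Delta> = 1)"
  proof -
    consider "n = 0" | "n = 1" | "n = 2" "\<Delta> \<ge> 2" | "n \<ge> 3"
      using \<open>\<not> (n = 2 \<and> \<Delta> = 1)\<close> assms(3) by linarith
    then show ?thesis
    proof cases
      \<comment> \<open>For \<open>n = 0\<close> and \<open>n = 1\<close> a family on the empty
        ground set suffices, so the minimum is 0.\<close>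
      case 1
      then show ?thesis
        using t_cff_distinct_le[of "{} :: nat set" "{}" n]
          cover_free_distinct_small[of "{} :: nat set set" 2] by simp
    next
      case 2
      then show ?thesis
        using t_cff_distinct_le[of "{} :: nat set" "{{}}" n]
          cover_free_distinct_small[of "{{}} :: nat set set" 2] by simp
    next
      \<comment> \<open>Since \<open>2 * \<Delta> - 2\<close> is positive, two distinct sets on one
        point form a vacuously cover-free family. One query is needed as well, to isolate the pair
        with nothing to avoid.\<close>
      case 3
      then obtain a b where "V = {a, b}" "a \<noteq> b"
        using assms(2) by (meson card_2_iff)
      then obtain Q where "Q \<in> \<Q>"
        using isolates_pairsD[OF iso, of a b "{}"] by auto
      then have "1 \<le> card \<Q>"
        using \<Q>(3) by (metis One_nat_def Suc_leI card_gt_0_iff empty_iff)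
      moreover have "cover_free_distinct 2 (2 * \<Delta> - 2) {{}, {0 :: nat}}"
        using 3(2) by (intro cover_free_distinct_small) auto
      then have "t_cff_distinct n 2 (2 * \<Delta> - 2) \<le> card {0 :: nat}"
        using 3(1) by (intro t_cff_distinct_le[of _ "{{}, {0}}"]) auto
      ultimately show ?thesis
        using \<Q>(2) by simp
    next
      case 4
      show ?thesis
        using t_cff_distinct_le[OF \<Q>(3) dual_subset_Pow card_dual[OF 4]
            cover_free_distinct_dual[OF iso]] \<Q>(2) by simp
    qed
  qed
  show "t_cff n 2 (2 * \<Delta> - 2) \<le> min_queries V \<Delta>" if "n \<ge> 3 \<and> n \<ge> 2 * \<Delta>"
  proof -
    \<comment> \<open>The condition \<open>r + 2 \<le> card V\<close> of
      \<open>cover_free_dual\<close> becomes \<open>2 * \<Delta> \<le> n\<close>.\<close>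
    have "cover_free 2 (2 * \<Delta> - 2) (dual \<Q> ` V)"
      using that assms(2,3) inj_on_dual[OF assms(1) _ assms(3) \<Q>(1)]
      by (intro cover_free_dual[OF assms(1) iso]) auto
    then show ?thesis
      using t_cff_le[OF \<Q>(3) dual_subset_Pow card_dual] that \<Q>(2) by simp
  qed
  show "min_queries V \<Delta> \<le> t_cff_distinct n 2 (2 * \<Delta>)"
    using t_cff_distinct_attained[of n "2 * \<Delta>"]
      min_queries_le_if_cover_free_distinct[OF assms(1,3)] assms(2) by metis
  show "min_queries V \<Delta> \<le> t_cff n 2 (2 * \<Delta>)"
    using t_cff_attained[of n "2 * \<Delta>"] cover_free_imp_distinct
      min_queries_le_if_cover_free_distinct[OF assms(1,3)] assms(2) by metis
qed

end
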